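(* Consider the panel stream and the W-TQA procedure described in the context, and fix any $t\ge2$. Assume the following. (i) (Mean-profile learnability) For each unit $k\in\{1,\dots,N+1\}$ there is a vector $\mu_k\in\mathbb R^d$ such that for every $\delta\in(0,1)$ and every round $r\ge2$, with probability at least $1-\delta$, $\max_{1\le k\le N+1}\|\widehat\mu_{k,r-1}-\mu_k\|_2\le\varepsilon_{r,\delta}$, where $\varepsilon_{r,\delta}\ge 0$ is a constant. (ii) (TV-profile control) There is a nondecreasing function $\phi:[0,\infty)\to[0,1]$ such that for every $r\ge1$ and $k=1,\dots,N$, almost surely, $d_{\mathrm{TV}}(P_r,P_{r,k}^{\mathrm{swap}})\le\phi(\|\mu_k-\mu_{N+1}\|_2)$. Define \[ \omega_k^\circ:=\frac{\exp(-\|\mu_k-\mu_{N+1}\|_2^2/(2h^2))}{1+\sum_{j=1}^N\exp(-\|\mu_j-\mu_{N+1}\|_2^2/(2h^2))},\qquad D_\mu:=\max_{1\le k\le N}\|\mu_k-\mu_{N+1}\|_2, \] $\phi_{\max}:=\max_{1\le k\le N}\phi(\|\mu_k-\mu_{N+1}\|_2)$, and $\bar\alpha_t:=\min\{1,\max\{0,\alpha_t\}\}$. Then, for every $\delta\in(0,1)$, on an event of probability at least $1-\delta$, \[ \mathbb P\!\left(Y_{N+1,t}\notin C_t(X_{N+1,t})\,\middle|\,\mathcal F_{t-1}^{+}\right)\le\bar\alpha_t+\sum_{k=1}^N\omega_k^\circ\,\phi\!\left(\|\mu_k-\mu_{N+1}\|_2\right)+\frac{8N\phi_{\max}}{h^2}\bigl(D_\mu\varepsilon_{t,\delta}+\varepsilon_{t,\delta}^2\bigr).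 \]
   Context: All random quantities live on a common probability space $(\Omega,\mathcal A,\mathbb P)$; conditional laws are regular conditional laws. Panel stream. Fix integers $N\ge1$, $d\ge1$. For units $i=1,\dots,N+1$ and rounds $t=1,2,\dots$ there are random pairs $(X_{i,t},Y_{i,t})\in\mathbb R^d\times\mathbb R$; units $1,\dots,N$ are calibration units and unit $N+1$ is the target. No exchangeability is assumed. $R_t\in\{0,1\}$ indicates whether $Y_{N+1,t}$ is revealed (after prediction); by convention $R_0=0$ and $Y_{N+1,0}=0$. The batch observed at round $t$ is $\mathcal O_t=(X_{1,t},Y_{1,t},\dots,X_{N,t},Y_{N,t},X_{N+1,t},R_{t-1},R_{t-1}Y_{N+1,t-1})$. Set $\mathcal F_t=\sigma(\mathcal O_1,\dots,\mathcal O_t)$, $\mathcal F_0$ trivial, and $\mathcal F_t^{+}=\mathcal F_t\vee\sigma(R_t,R_tY_{N+1,t})$. Score. $\hat s:\mathbb R^d\times\mathbb R\to\mathbb R$ is a fixed (nonrandom) measurable function, and $\hat s_{i,t}:=\hat s(X_{i,t},Y_{i,t})$. W-TQA procedure, with parameters $\alpha\in[0,1]$, bandwidth $h>0$, stepsize $\gamma>0$. Initialize $\alpha_0=\alpha$, $\widehat\mu_{k,0}=0$, and $w^{(1)}_{N+1,k}=1/(N+1)$ for $k=1,\dots,N+1$. At each round $t=1,2,\dots$: (1) If $R_{t-1}=1$, set $\alpha_t=\alpha_{t-1}+\gamma(\alpha-\ell_{t-1})$, where $\ell_{t-1}=\mathbf 1\{Y_{N+1,t-1}\notin C_{t-1}(X_{N+1,t-1})\}$;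 otherwise set $\alpha_t=\alpha_{t-1}$. (2) Let $\widetilde s_t=(\hat s_{1,t},\dots,\hat s_{N,t},+\infty)$ and $\hat q_t=\inf\{q\in[-\infty,+\infty]:\sum_{k=1}^{N+1}w^{(t)}_{N+1,k}\mathbf 1\{(\widetilde s_t)_k\le q\}\ge 1-\alpha_t\}$, with $\inf\emptyset=+\infty$. The prediction set is $C_t(X_{N+1,t})=\{y\in\mathbb R:\hat s(X_{N+1,t},y)\le\hat q_t\}$ (so $\alpha_t>1$ gives the empty set, $\alpha_t<0$ gives $\mathbb R$). (3) Set $\widehat\mu_{k,t}=\frac1t\sum_{s=1}^tX_{k,s}$ for $k\le N+1$, $a_{k,t}=\exp\{-\|\widehat\mu_{k,t}-\widehat\mu_{N+1,t}\|_2^2/(2h^2)\}$ for $k\le N$, $a_{N+1,t}=1$, and $w^{(t+1)}_{N+1,k}=a_{k,t}/\sum_{j=1}^{N+1}a_{j,t}$ for $k\le N+1$. Laws. $P_t:=\mathcal L((\hat s_{1,t},\dots,\hat s_{N,t},\hat s_{N+1,t})\mid\mathcal F_{t-1}^{+})$, and for $k\in\{1,\dots,N\}$, $P_{t,k}^{\mathrm{swap}}$ is the conditional law given $\mathcal F_{t-1}^{+}$ of the vector obtained by swapping the $k$-th and $(N+1)$-th coordinates $\hat s_{k,t}$ and $\hat s_{N+1,t}$. $d_{\mathrm{TV}}(P,Q)=\sup_A|P(A)-Q(A)|$ is total variation distance. Inequalities between conditional probabilities are understood up to $\mathbb P$-null sets. *)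

theory Defs
  imports "HOL-Probability.Probability"
begin

text \<open>
  Units are indexed by \<open>{1..N+1}\<close>, the target being \<open>N+1\<close>; rounds are \<open>1, 2, \<dots>\<close>, index \<open>0\<close> being
  used only for the conventions on \<open>R\<close> and on \<open>Y (N+1)\<close>. The revelation indicator \<open>R\<close> is
  real-valued with values in \<open>{0, 1}\<close>.
\<close>

subsection \<open>Conditional laws and total variation\<close>

definition regular_cond_law ::
  "'a measure \<Rightarrow> 'a measure \<Rightarrow> 'b measure \<Rightarrow> ('a \<Rightarrow> 'b) \<Rightarrow> ('a \<Rightarrow> 'b measure) \<Rightarrow> bool" where
  "regular_cond_law M F S Z \<kappa> \<longleftrightarrow>
     \<kappa> \<in> F \<rightarrow>\<^sub>M prob_algebra S \<and>
     (\<forall>A\<in>sets S. AE \<omega> in M.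
        measure (\<kappa> \<omega>) A = real_cond_exp M F (indicator (Z -` A \<inter> space M)) \<omega>)"

text \<open>Meant for two probability measures with the same \<open>\<sigma>\<close>-algebra.\<close>

definition tv_dist :: "'b measure \<Rightarrow> 'b measure \<Rightarrow> real" where
  "tv_dist P Q = (SUP A\<in>sets P. \<bar>measure P A - measure Q A\<bar>)"

subsection \<open>Observations and information\<close>

type_synonym 'd batch = "(nat \<Rightarrow> (real ^ 'd) \<times> real) \<times> (real ^ 'd) \<times> real \<times> real"

definition batch_space :: "nat \<Rightarrow> ('d::finite) batch measure" where
  "batch_space N =
     (\<Pi>\<^sub>M i\<in>{1..N}. borel \<Otimes>\<^sub>M borel) \<Otimes>\<^sub>M borel \<Otimes>\<^sub>M borel \<Otimes>\<^sub>M borel"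

definition batch ::
  "nat \<Rightarrow> (nat \<Rightarrow> nat \<Rightarrow> 'a \<Rightarrow> real ^ 'd) \<Rightarrow> (nat \<Rightarrow> nat \<Rightarrow> 'a \<Rightarrow> real) \<Rightarrow> (nat \<Rightarrow> 'a \<Rightarrow> real)
    \<Rightarrow> nat \<Rightarrow> 'a \<Rightarrow> ('d::finite) batch" where
  "batch N X Y R t \<omega> =
     ((\<lambda>i\<in>{1..N}. (X i t \<omega>, Y i t \<omega>)), X (N+1) t \<omega>,
      R (t - 1) \<omega>, R (t - 1) \<omega> * Y (N+1) (t - 1) \<omega>)"

definition info ::
  "'a measure \<Rightarrow> nat \<Rightarrow> (nat \<Rightarrow> nat \<Rightarrow> 'a \<Rightarrow> real ^ ('d::finite)) \<Rightarrow> (nat \<Rightarrow> nat \<Rightarrow> 'a \<Rightarrow> real)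
    \<Rightarrow> (nat \<Rightarrow> 'a \<Rightarrow> real) \<Rightarrow> nat \<Rightarrow> 'a measure" where
  "info M N X Y R t =
     sigma (space M)
       (\<Union>s\<in>{1..t}. {batch N X Y R s -` A \<inter> space M | A. A \<in> sets (batch_space N :: 'd batch measure)})"

definition info_plus ::
  "'a measure \<Rightarrow> nat \<Rightarrow> (nat \<Rightarrow> nat \<Rightarrow> 'a \<Rightarrow> real ^ ('d::finite)) \<Rightarrow> (nat \<Rightarrow> nat \<Rightarrow> 'a \<Rightarrow> real)
    \<Rightarrow> (nat \<Rightarrow> 'a \<Rightarrow> real) \<Rightarrow> nat \<Rightarrow> 'a measure" where
  "info_plus M N X Y R t =
     sigma (space M)
       (sets (info M N X Y R t) \<union>
        {(\<lambda>\<omega>. (R t \<omega>, R t \<omega> * Y (N+1) t \<omega>)) -` A \<inter> space M | A.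
           A \<in> sets (borel \<Otimes>\<^sub>M borel)})"

subsection \<open>Scores\<close>

definition score_vec ::
  "nat \<Rightarrow> ((real ^ 'd) \<times> real \<Rightarrow> real) \<Rightarrow> (nat \<Rightarrow> nat \<Rightarrow> 'a \<Rightarrow> real ^ 'd)
    \<Rightarrow> (nat \<Rightarrow> nat \<Rightarrow> 'a \<Rightarrow> real) \<Rightarrow> nat \<Rightarrow> 'a \<Rightarrow> nat \<Rightarrow> real" where
  "score_vec N s X Y t \<omega> = (\<lambda>i\<in>{1..N+1}. s (X i t \<omega>, Y i t \<omega>))"

definition score_space :: "nat \<Rightarrow> (nat \<Rightarrow> real) measure" where
  "score_space N = (\<Pi>\<^sub>M i\<in>{1..N+1}. borel)"

definition swap_coords :: "nat \<Rightarrow> nat \<Rightarrow> (nat \<Rightarrow> 'b) \<Rightarrow> nat \<Rightarrow> 'b" where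
  "swap_coords k n v = v(k := v n, n := v k)"

subsection \<open>The W-TQA procedure\<close>

text \<open>For \<open>t = 0\<close> the value is \<open>0\<close>, since \<open>1 / 0 = 0\<close>.\<close>

definition mean_profile :: "(nat \<Rightarrow> nat \<Rightarrow> 'a \<Rightarrow> real ^ 'd) \<Rightarrow> nat \<Rightarrow> nat \<Rightarrow> 'a \<Rightarrow> real ^ ('d::finite)" where
  "mean_profile X k t \<omega> = (1 / real t) *\<^sub>R (\<Sum>s=1..t. X k s \<omega>)"

definition affinity ::
  "nat \<Rightarrow> real \<Rightarrow> (nat \<Rightarrow> nat \<Rightarrow> 'a \<Rightarrow> real ^ ('d::finite)) \<Rightarrow> nat \<Rightarrow> nat \<Rightarrow> 'a \<Rightarrow> real" where
  "affinity N h X k t \<omega> =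
     (if k \<le> N
      then exp (- (norm (mean_profile X k t \<omega> - mean_profile X (N+1) t \<omega>))\<^sup>2 / (2 * h\<^sup>2))
      else 1)"

text \<open>\<open>weight N h X t k\<close> is the weight of unit \<open>k\<close> used in round \<open>t\<close>; it is computed from the
  mean profiles at the end of round \<open>t - 1\<close>.\<close>

definition weight ::
  "nat \<Rightarrow> real \<Rightarrow> (nat \<Rightarrow> nat \<Rightarrow> 'a \<Rightarrow> real ^ ('d::finite)) \<Rightarrow> nat \<Rightarrow> nat \<Rightarrow> 'a \<Rightarrow> real" where
  "weight N h X t k \<omega> =
     (if t \<le> 1 then 1 / (real N + 1)
      else affinity N h X k (t - 1) \<omega> / (\<Sum>j=1..N+1. affinity N h X j (t - 1) \<omega>))"

definition weighted_quantile :: "nat \<Rightarrow> (nat \<Rightarrow> real) \<Rightarrow> (nat \<Rightarrow> ereal) \<Rightarrow> real \<Rightarrow> ereal" where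
  "weighted_quantile n w v \<tau> = Inf {q. (\<Sum>k=1..n. w k * of_bool (v k \<le> q)) \<ge> \<tau>}"

text \<open>The threshold and the prediction set of round \<open>t\<close> as functions of the working level \<open>a\<close>.\<close>

definition threshold_at ::
  "nat \<Rightarrow> real \<Rightarrow> ((real ^ ('d::finite)) \<times> real \<Rightarrow> real) \<Rightarrow> (nat \<Rightarrow> nat \<Rightarrow> 'a \<Rightarrow> real ^ 'd)
    \<Rightarrow> (nat \<Rightarrow> nat \<Rightarrow> 'a \<Rightarrow> real) \<Rightarrow> real \<Rightarrow> nat \<Rightarrow> 'a \<Rightarrow> ereal" where
  "threshold_at N h s X Y a t \<omega> =
     weighted_quantile (N+1) (\<lambda>k. weight N h X t k \<omega>)
       (\<lambda>k. if k \<le> N then ereal (s (X k t \<omega>, Y k t \<omega>)) else \<infinity>) (1 - a)"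

definition pred_set_at ::
  "nat \<Rightarrow> real \<Rightarrow> ((real ^ ('d::finite)) \<times> real \<Rightarrow> real) \<Rightarrow> (nat \<Rightarrow> nat \<Rightarrow> 'a \<Rightarrow> real ^ 'd)
    \<Rightarrow> (nat \<Rightarrow> nat \<Rightarrow> 'a \<Rightarrow> real) \<Rightarrow> real \<Rightarrow> nat \<Rightarrow> 'a \<Rightarrow> real set" where
  "pred_set_at N h s X Y a t \<omega> =
     {y. ereal (s (X (N+1) t \<omega>, y)) \<le> threshold_at N h s X Y a t \<omega>}"

primrec level ::
  "nat \<Rightarrow> real \<Rightarrow> real \<Rightarrow> real \<Rightarrow> ((real ^ ('d::finite)) \<times> real \<Rightarrow> real)
    \<Rightarrow> (nat \<Rightarrow> nat \<Rightarrow> 'a \<Rightarrow> real ^ 'd) \<Rightarrow> (nat \<Rightarrow> nat \<Rightarrow> 'a \<Rightarrow> real) \<Rightarrow> (nat \<Rightarrow> 'a \<Rightarrow> real)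
    \<Rightarrow> nat \<Rightarrow> 'a \<Rightarrow> real" where
  "level N \<alpha> h \<gamma> s X Y R 0 = (\<lambda>\<omega>. \<alpha>)"
| "level N \<alpha> h \<gamma> s X Y R (Suc t) = (\<lambda>\<omega>.
     if R t \<omega> = 1
     then level N \<alpha> h \<gamma> s X Y R t \<omega> +
       \<gamma> * (\<alpha> - of_bool (Y (N+1) t \<omega> \<notin> pred_set_at N h s X Y (level N \<alpha> h \<gamma> s X Y R t \<omega>) t \<omega>))
     else level N \<alpha> h \<gamma> s X Y R t \<omega>)"

definition pred_set ::
  "nat \<Rightarrow> real \<Rightarrow> real \<Rightarrow> real \<Rightarrow> ((real ^ ('d::finite)) \<times> real \<Rightarrow> real)
    \<Rightarrow> (nat \<Rightarrow> nat \<Rightarrow> 'a \<Rightarrow> real ^ 'd) \<Rightarrow> (nat \<Rightarrow> nat \<Rightarrow> 'a \<Rightarrow> real) \<Rightarrow> (nat \<Rightarrow> 'a \<Rightarrow> real)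
    \<Rightarrow> nat \<Rightarrow> 'a \<Rightarrow> real set" where
  "pred_set N \<alpha> h \<gamma> s X Y R t \<omega> = pred_set_at N h s X Y (level N \<alpha> h \<gamma> s X Y R t \<omega>) t \<omega>"

subsection \<open>Oracle quantities\<close>

definition profile_gap :: "nat \<Rightarrow> (nat \<Rightarrow> real ^ ('d::finite)) \<Rightarrow> nat \<Rightarrow> real" where
  "profile_gap N \<mu> k = norm (\<mu> k - \<mu> (N+1))"

definition oracle_weight :: "nat \<Rightarrow> real \<Rightarrow> (nat \<Rightarrow> real ^ ('d::finite)) \<Rightarrow> nat \<Rightarrow> real" where
  "oracle_weight N h \<mu> k =
     exp (- (profile_gap N \<mu> k)\<^sup>2 / (2 * h\<^sup>2)) /
     (1 + (\<Sum>j=1..N. exp (- (profile_gap N \<mu> j)\<^sup>2 / (2 * h\<^sup>2))))"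

definition max_gap :: "nat \<Rightarrow> (nat \<Rightarrow> real ^ ('d::finite)) \<Rightarrow> real" where
  "max_gap N \<mu> = (MAX k\<in>{1..N}. profile_gap N \<mu> k)"

definition max_phi :: "nat \<Rightarrow> (real \<Rightarrow> real) \<Rightarrow> (nat \<Rightarrow> real ^ ('d::finite)) \<Rightarrow> real" where
  "max_phi N \<phi> \<mu> = (MAX k\<in>{1..N}. \<phi> (profile_gap N \<mu> k))"

end

theory Submission
  imports Defs
begin

text \<open>
  A score exceeds the weighted quantile iff the units with strictly smaller score carry weight at
  least \<open>1 - a\<close>. Hence the miscoverage event depends on the past only through the finite family of
  index sets that are heavy in this sense. If the target's score is exceeding, then after swapping
  units \<open>k\<close> and \<open>N + 1\<close> the score of unit \<open>k\<close> is exceeding; passing back to the unswapped law costs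
  \<open>tv_dist\<close>, and averaging over \<open>k\<close> with the weights leaves the total weight of the exceeding units,
  which is at most \<open>min 1 (max 0 a)\<close>. Replacing the estimated weights by the oracle ones costs
  \<open>4 N max_phi / h\<^sup>2 * (max_gap \<epsilon> + \<epsilon>\<^sup>2)\<close>, since \<open>exp (- x)\<close> is 1-Lipschitz for \<open>x \<ge> 0\<close>.
\<close>

subsection \<open>Weighted quantiles and swaps\<close>

lemma sum_mult_of_bool:
  fixes w :: "'i \<Rightarrow> real"
  assumes "finite I"
  shows "(\<Sum>k\<in>I. w k * of_bool (p k)) = sum w {k\<in>I. p k}"
  using assms by (simp add: sum.inter_filter[symmetric] of_bool_def if_distrib cong: if_cong)

text \<open>The weighted distribution function of \<open>v\<close> jumps only at values of
  \<open>v\<close>, so among all \<open>q < c\<close> the largest value of \<open>v\<close> below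
  \<open>c\<close> already collects the most weight. This replaces the infimum by a finite
  sum.\<close>

lemma weighted_quantile_less_iff:
  fixes v :: "nat \<Rightarrow> ereal"
  assumes w: "\<And>k. k \<in> {1..n} \<Longrightarrow> 0 \<le> w k" and c: "c \<noteq> -\<infinity>"
  shows "weighted_quantile n w v \<tau> < c \<longleftrightarrow> \<tau> \<le> sum w {k\<in>{1..n}. v k < c}"
proof
  assume "weighted_quantile n w v \<tau> < c"
  then obtain q where q: "\<tau> \<le> sum w {k\<in>{1..n}. v k \<le> q}" "q < c"
    unfolding weighted_quantile_def sum_mult_of_bool[OF finite_atLeastAtMost] Inf_less_iff by auto
  moreover have "sum w {k\<in>{1..n}. v k \<le> q} \<le> sum w {k\<in>{1..n}. v k < c}"
    using w q by (intro sum_mono2) auto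
  ultimately show "\<tau> \<le> sum w {k\<in>{1..n}. v k < c}" by simp
next
  assume le: "\<tau> \<le> sum w {k\<in>{1..n}. v k < c}"
  \<comment> \<open>Inserting \<open>-\<infinity>\<close> provides a witness when no
    \<open>v k\<close> lies below \<open>c\<close>, in which case the sum is \<open>0\<close>; it is
    below \<open>c\<close> because \<open>c \<noteq> -\<infinity>\<close>.\<close>
  define V where "V = insert (-\<infinity>) (v ` {k\<in>{1..n}. v k < c})"
  have V: "finite V" "V \<noteq> {}" unfolding V_def by auto
  have less: "Max V < c" using V c by (auto simp: V_def)
  moreover have "v k \<le> Max V \<longleftrightarrow> v k < c" if "k \<in> {1..n}" for k
  proof
    assume "v k < c"
    with that have "v k \<in> V" by (auto simp: V_def)
    then show "v k \<le> Max V" using V by (intro Max_ge)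
  qed (use less in order)
  then have "{k\<in>{1..n}. v k \<le> Max V} = {k\<in>{1..n}. v k < c}" by auto
  ultimately show "weighted_quantile n w v \<tau> < c"
    unfolding weighted_quantile_def sum_mult_of_bool[OF finite_atLeastAtMost] Inf_less_iff
    using le by (auto intro!: exI[of _ "Max V"])
qed

text \<open>An exceeding unit \<open>m\<close> with the smallest value has weight at least
  \<open>1 - a\<close> strictly below it, and none of that weight belongs to exceeding units. The
  total being \<open>1\<close>, at most \<open>a\<close> is left for them. If no unit exceeds, the
  sum is \<open>0\<close>, hence \<open>max 0 a\<close>.\<close>

lemma sum_weights_exceeding_le:
  fixes v :: "'i \<Rightarrow> real" and w :: "'i \<Rightarrow> real"
  assumes I: "finite I" and w: "\<And>k. k \<in> I \<Longrightarrow> 0 \<le> w k" and sum1: "sum w I = 1"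
  shows "sum w {k\<in>I. 1 - a \<le> sum w {j\<in>I. v j < v k}} \<le> min 1 (max 0 a)"
proof -
  define K where "K = {k\<in>I. 1 - a \<le> sum w {j\<in>I. v j < v k}}"
  have K: "finite K" "K \<subseteq> I" using I by (auto simp: K_def)
  have "sum w K \<le> max 0 a"
  proof (cases "K = {}")
    case False
    obtain m where m: "m \<in> K" "\<And>k. k \<in> K \<Longrightarrow> v m \<le> v k"
      using K(1) False by (metis ex_is_arg_min_if_finite is_arg_min_linorder)
    have "sum w K + sum w {j\<in>I. v j < v m} = sum w (K \<union> {j\<in>I. v j < v m})"
      using K I m by (subst sum.union_disjoint) (auto simp: not_less[symmetric])
    also have "\<dots> \<le> sum w I" using w K I by (intro sum_mono2) auto
    finally have "sum w K \<le> a" using m(1) sum1 by (simp add: K_def)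
    then show ?thesis by simp
  qed simp
  moreover have "sum w K \<le> sum w I" using w K I by (intro sum_mono2) auto
  ultimately show ?thesis using sum1 by (simp add: K_def)
qed

section \<open>Exceedance events in score space and their behaviour under swaps\<close>

definition exceed :: "nat \<Rightarrow> nat set set \<Rightarrow> nat \<Rightarrow> (nat \<Rightarrow> real) set" where
  "exceed N H k = {v \<in> space (score_space N). {j\<in>{1..N+1}. v j < v k} \<in> H}"

text \<open>Restricting to subsets of \<open>{1..N+1}\<close> confines the family to the finite set
  \<open>Pow (Pow {1..N+1})\<close>. As \<open>exceed\<close> takes such a family instead of weights
  and a level, only finitely many events in score space ever occur.\<close>

definition heavy :: "nat \<Rightarrow> (nat \<Rightarrow> real) \<Rightarrow> real \<Rightarrow> nat set set" where
  "heavy N w a = {J. J \<subseteq> {1..N+1} \<and> 1 - a \<le> sum w J}"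

text \<open>Reduces measurability of the random heavy family to finitely many comparisons of
  \<open>1 - a\<close> with \<open>sum w J\<close>.\<close>

lemma heavy_eq_iff:
  assumes "H \<subseteq> Pow {1..N+1}"
  shows "heavy N w a = H \<longleftrightarrow> (\<forall>J\<in>Pow {1..N+1}. 1 - a \<le> sum w J \<longleftrightarrow> J \<in> H)"
proof
  assume "\<forall>J\<in>Pow {1..N+1}. 1 - a \<le> sum w J \<longleftrightarrow> J \<in> H"
  with assms have "J \<in> heavy N w a \<longleftrightarrow> J \<in> H" for J
    unfolding heavy_def by blast
  then show "heavy N w a = H" by blast
qed (auto simp: heavy_def)

lemma measurable_score_component:
  "k \<in> {1..N+1} \<Longrightarrow> (\<lambda>v. v k) \<in> borel_measurable (score_space N)"
  unfolding score_space_def by (rule measurable_component_singleton)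

text \<open>The event splits according to which of the finitely many sets \<open>J\<close> of units
  scores below \<open>k\<close>; each piece is a finite conjunction of coordinate comparisons or
  their negations.\<close>

lemma exceed_sets:
  assumes k: "k \<in> {1..N+1}"
  shows "exceed N H k \<in> sets (score_space N)"
proof -
  have "{j\<in>{1..N+1}. v j < v k} \<in> H \<longleftrightarrow>
      (\<exists>J \<in> H \<inter> Pow {1..N+1}. \<forall>j\<in>{1..N+1}. v j < v k \<longleftrightarrow> j \<in> J)" for v :: "nat \<Rightarrow> real"
  proof
    assume "\<exists>J \<in> H \<inter> Pow {1..N+1}. \<forall>j\<in>{1..N+1}. v j < v k \<longleftrightarrow> j \<in> J"
    then obtain J where "J \<in> H" "J \<subseteq> {1..N+1}" "\<forall>j\<in>{1..N+1}. v j < v k \<longleftrightarrow> j \<in> J" by blast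
    then have "{j\<in>{1..N+1}. v j < v k} = J" by blast
    with \<open>J \<in> H\<close> show "{j\<in>{1..N+1}. v j < v k} \<in> H" by simp
  qed (intro bexI[of _ "{j\<in>{1..N+1}. v j < v k}"], auto)
  then have "exceed N H k = (\<Union>J \<in> H \<inter> Pow {1..N+1}.
      {v \<in> space (score_space N). \<forall>j\<in>{1..N+1}. v j < v k \<longleftrightarrow> j \<in> J})"
    unfolding exceed_def by blast
  moreover have "{v \<in> space (score_space N). \<forall>j\<in>{1..N+1}. v j < v k \<longleftrightarrow> j \<in> J} \<in> sets (score_space N)" for J
  proof (rule sets.sets_Collect_finite_All')
    fix j assume "j \<in> {1..N+1}"
    then have "{v \<in> space (score_space N). v j < v k} \<in> sets (score_space N)"
      by (intro borel_measurable_less measurable_score_component k)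
    then show "{v \<in> space (score_space N). v j < v k \<longleftrightarrow> j \<in> J} \<in> sets (score_space N)"
      by (cases "j \<in> J") (simp_all add: sets.sets_Collect_neg del: not_less)
  qed auto
  ultimately show ?thesis by (auto intro!: sets.finite_UN)
qed

lemma swap_coords_space:
  assumes "k \<in> {1..N+1}" "v \<in> space (score_space N)"
  shows "swap_coords k (N+1) v \<in> space (score_space N)"
  using assms by (auto simp: score_space_def space_PiM swap_coords_def PiE_def extensional_def)

lemma swap_coords_measurable:
  assumes k: "k \<in> {1..N+1}"
  shows "swap_coords k (N+1) \<in> score_space N \<rightarrow>\<^sub>M score_space N"
  unfolding score_space_def
proof (rule measurable_PiM_single')
  fix i assume "i \<in> {1..N+1}"
  then show "(\<lambda>v. swap_coords k (N+1) v i) \<in> borel_measurable (Pi\<^sub>M {1..N+1} (\<lambda>_. borel :: real measure))"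
    using k by (cases "i = N+1"; cases "i = k") (auto simp: swap_coords_def intro!: measurable_component_singleton)
next
  show "swap_coords k (N+1) \<in> space (Pi\<^sub>M {1..N+1} (\<lambda>_. borel)) \<rightarrow> {1..N+1} \<rightarrow>\<^sub>E space (borel :: real measure)"
    using k by (auto simp: space_PiM swap_coords_def PiE_def extensional_def)
qed

text \<open>If unit \<open>k\<close> scores below the target, then the swap trades its weight \<open>w k\<close> below the
  exceeding score for \<open>w (N+1)\<close>, which is at least as large; otherwise no weight is lost.\<close>

lemma exceed_swap:
  assumes k: "k \<in> {1..N}" and w: "\<And>j. j \<in> {1..N+1} \<Longrightarrow> 0 \<le> w j" and wk: "w k \<le> w (N+1)"
    and v: "v \<in> exceed N (heavy N w a) (N+1)"
  shows "swap_coords k (N+1) v \<in> exceed N (heavy N w a) k"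
proof -
  let ?u = "swap_coords k (N+1) v"
  define A where "A = {j\<in>{1..N+1}. v j < v (N+1)}"
  define B where "B = {j\<in>{1..N+1}. ?u j < ?u k}"
  have fin: "finite A" "finite B" and sub: "A \<subseteq> {1..N+1}" "B \<subseteq> {1..N+1}" by (auto simp: A_def B_def)
  have "sum w A \<le> sum w B"
  proof (cases "k \<in> A")
    case True
    \<comment> \<open>\<open>?u k\<close> is the old target score and \<open>?u (N+1)\<close> the
      old score of \<open>k\<close>, so passing from \<open>A\<close> to \<open>B\<close> exchanges
      \<open>k\<close> for \<open>N+1\<close>.\<close>
    then have "N+1 \<in> B" and "A - {k} \<subseteq> B - {N+1}" using k by (auto simp: A_def B_def swap_coords_def)
    then have "sum w (A - {k}) \<le> sum w (B - {N+1})" using fin sub w by (intro sum_mono2) auto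
    then show ?thesis using True \<open>N+1 \<in> B\<close> fin wk by (simp add: sum_diff1)
  next
    case False
    then have "A \<subseteq> B" using k by (auto simp: A_def B_def swap_coords_def)
    then show ?thesis using fin sub w by (intro sum_mono2) auto
  qed
  moreover have "?u \<in> space (score_space N)" using v k by (intro swap_coords_space) (auto simp: exceed_def)
  ultimately show ?thesis using v sub
    unfolding exceed_def heavy_def mem_Collect_eq A_def[symmetric] B_def[symmetric] by auto
qed

section \<open>Total variation and averaging over the swaps\<close>

lemma abs_measure_diff_le_tv_dist:
  assumes "prob_space P" "prob_space Q" "A \<in> sets P"
  shows "\<bar>measure P A - measure Q A\<bar> \<le> tv_dist P Q"
  unfolding tv_dist_def
\<comment> \<open>A real supremum is known to dominate its members only over a bounded set;
  \<open>1\<close> is a bound because both measures have mass one.\<close>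
proof (rule cSUP_upper[OF assms(3)], rule bdd_aboveI2)
  fix B
  have "0 \<le> measure P B" "measure P B \<le> 1" "0 \<le> measure Q B" "measure Q B \<le> 1"
    using assms by (auto intro: prob_space.prob_le_1)
  then show "\<bar>measure P B - measure Q B\<bar> \<le> 1" by linarith
qed

text \<open>Laws, weights and level are fixed here; the lemma is later applied at each outcome.
  \<open>Qs k\<close> is tied to \<open>Q\<close> on a single event only, which is all that
  comparing two conditional laws event by event, up to null sets, has to supply.\<close>

lemma measure_exceed_le:
  assumes Q: "Q \<in> space (prob_algebra (score_space N))"
    and Qs: "\<And>k. k \<in> {1..N} \<Longrightarrow> Qs k \<in> space (prob_algebra (score_space N))"
    and swap: "\<And>k. k \<in> {1..N} \<Longrightarrow> measure (Qs k) (exceed N (heavy N w a) k) =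
      measure Q (swap_coords k (N+1) -` exceed N (heavy N w a) k \<inter> space (score_space N))"
    and w: "\<And>j. j \<in> {1..N+1} \<Longrightarrow> 0 \<le> w j" and sum1: "sum w {1..N+1} = 1"
    and wk: "\<And>k. k \<in> {1..N} \<Longrightarrow> w k \<le> w (N+1)"
  shows "measure Q (exceed N (heavy N w a) (N+1)) \<le>
    min 1 (max 0 a) + (\<Sum>k=1..N. w k * tv_dist Q (Qs k))"
proof -
  let ?D = "exceed N (heavy N w a)"
  interpret Q: prob_space Q using Q by (auto simp: space_prob_algebra)
  have sQ [simp]: "sets Q = sets (score_space N)" using Q by (auto simp: space_prob_algebra)
  have spQ: "space Q = space (score_space N)" by (rule sets_eq_imp_space_eq[OF sQ])
  have D: "?D k \<in> sets Q" if "k \<in> {1..N+1}" for k using exceed_sets[OF that] by simp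
  have step: "measure Q (?D (N+1)) \<le> measure Q (?D k) + tv_dist Q (Qs k)" if k: "k \<in> {1..N}" for k
  proof -
    have "measure Q (?D (N+1)) \<le> measure Q (swap_coords k (N+1) -` ?D k \<inter> space (score_space N))"
    proof (rule Q.finite_measure_mono)
      show "?D (N+1) \<subseteq> swap_coords k (N+1) -` ?D k \<inter> space (score_space N)"
        using exceed_swap[OF k w wk[OF k]] by (auto simp: exceed_def)
      show "swap_coords k (N+1) -` ?D k \<inter> space (score_space N) \<in> sets Q"
        unfolding sQ using k by (intro measurable_sets[OF swap_coords_measurable] exceed_sets) auto
    qed
    also have "\<dots> = measure (Qs k) (?D k)" using swap[OF k] by simp
    also have "\<dots> \<le> measure Q (?D k) + tv_dist Q (Qs k)"
      using abs_measure_diff_le_tv_dist[of Q "Qs k" "?D k"] Qs[OF k] k D[of k] Q.prob_space_axioms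
      by (auto simp: space_prob_algebra)
    finally show ?thesis .
  qed
  \<comment> \<open>The weights sum to \<open>1\<close>, so the left side is its own weighted
    average. The terms up to \<open>N\<close> are treated by \<open>step\<close>; the target's term
    needs no swap and stays as it is.\<close>
  have "measure Q (?D (N+1)) = (\<Sum>k=1..N+1. w k * measure Q (?D (N+1)))"
    using sum1 by (simp flip: sum_distrib_right)
  also have "\<dots> \<le> (\<Sum>k=1..N. w k * (measure Q (?D k) + tv_dist Q (Qs k))) + w (N+1) * measure Q (?D (N+1))"
    using step w by (auto intro!: sum_mono mult_left_mono)
  also have "\<dots> = (\<Sum>k=1..N+1. w k * measure Q (?D k)) + (\<Sum>k=1..N. w k * tv_dist Q (Qs k))"
    by (simp add: distrib_left sum.distrib)
  \<comment> \<open>Read as an expectation, the sum of probabilities is the mean total weight of the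
    exceeding units, which is bounded at every \<open>v\<close>.\<close>
  also have "(\<Sum>k=1..N+1. w k * measure Q (?D k)) = (\<integral>v. (\<Sum>k=1..N+1. w k * indicator (?D k) v) \<partial>Q)"
    using D by (subst Bochner_Integration.integral_sum) (auto simp: less_top[symmetric])
  also have "\<dots> \<le> (\<integral>v. min 1 (max 0 a) \<partial>Q)"
  proof (rule integral_mono)
    fix v assume v: "v \<in> space Q"
    have "(\<Sum>k=1..N+1. w k * indicator (?D k) v) = (\<Sum>k\<in>{1..N+1}. if 1 - a \<le> sum w {j\<in>{1..N+1}. v j < v k} then w k else 0)"
      using v by (intro sum.cong refl) (auto simp: exceed_def heavy_def spQ indicator_def)
    also have "\<dots> = sum w {k\<in>{1..N+1}. 1 - a \<le> sum w {j\<in>{1..N+1}. v j < v k}}"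
      by (rule sum.inter_filter[symmetric]) simp
    also have "\<dots> \<le> min 1 (max 0 a)"
      by (rule sum_weights_exceeding_le[OF _ w sum1]) auto
    finally show "(\<Sum>k=1..N+1. w k * indicator (?D k) v) \<le> min 1 (max 0 a)" .
  next
    show "integrable Q (\<lambda>v. \<Sum>k=1..N+1. w k * indicator (?D k) v)"
      using D by (intro Bochner_Integration.integrable_sum integrable_mult_right)
        (simp add: integrable_indicator_iff less_top[symmetric])
  qed simp
  finally show ?thesis by (simp add: Q.prob_space)
qed

subsection \<open>Conditional laws and past information\<close>

text \<open>Only finitely many values \<open>T \<omega>\<close> occur, so conditioning on \<open>F\<close> freezes \<open>T\<close> without any
  disintegration theorem.\<close>

lemma real_cond_exp_finite_param:
  assumes M: "prob_space M" and sub: "subalgebra M F"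
    and law: "regular_cond_law M F S Z \<kappa>" and Z: "Z \<in> M \<rightarrow>\<^sub>M S"
    and C: "finite C" and T: "T \<in> F \<rightarrow>\<^sub>M count_space C"
    and D: "\<And>c. c \<in> C \<Longrightarrow> D c \<in> sets S"
  shows "AE \<omega> in M. real_cond_exp M F (indicator {\<omega>\<in>space M. Z \<omega> \<in> D (T \<omega>)}) \<omega> =
    measure (\<kappa> \<omega>) (D (T \<omega>))"
proof -
  interpret prob_space M by fact
  interpret sigma_finite_subalgebra M F
    by (rule finite_measure_subalgebra_is_sigma_finite) (unfold_locales, fact)
  have spF: "space F = space M" using sub by (simp add: subalgebra_def)
  have TC: "T \<omega> \<in> C" if "\<omega> \<in> space M" for \<omega>
    using measurable_space[OF T] that spF by auto
  define f :: "_ \<Rightarrow> _ \<Rightarrow> real" where "f c = indicator (T -` {c} \<inter> space M)" for c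
  define g :: "_ \<Rightarrow> _ \<Rightarrow> real" where "g c = indicator (Z -` D c \<inter> space M)" for c
  have f: "f c \<in> borel_measurable F" if "c \<in> C" for c
    unfolding f_def using measurable_sets[OF T, of "{c}"] that spF by auto
  have fM: "f c \<in> borel_measurable M" if "c \<in> C" for c
    by (rule measurable_from_subalg[OF sub f[OF that]])
  have g: "g c \<in> borel_measurable M" if "c \<in> C" for c
    unfolding g_def using measurable_sets[OF Z D[OF that]] by auto
  \<comment> \<open>The sum rule used below wants integrability for every \<open>c\<close>. Outside
    \<open>C\<close> the set \<open>D c\<close> may fail to be measurable, but \<open>f c\<close> is
    then identically \<open>0\<close>.\<close>
  have int: "integrable M (\<lambda>\<omega>. f c \<omega> * g c \<omega>)" for c
  proof (cases "c \<in> C")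
    case True
    show ?thesis
    proof (rule integrable_const_bound[where B=1])
      show "(\<lambda>\<omega>. f c \<omega> * g c \<omega>) \<in> borel_measurable M"
        using fM[OF True] g[OF True] by (rule borel_measurable_times)
    qed (auto simp: f_def g_def indicator_def)
  next
    case False
    then have "T -` {c} \<inter> space M = {}" using TC by auto
    then show ?thesis by (simp add: f_def)
  qed
  have split: "indicator {\<omega>\<in>space M. Z \<omega> \<in> D (T \<omega>)} \<omega> = (\<Sum>c\<in>C. f c \<omega> * g c \<omega>)"
    if "\<omega> \<in> space M" for \<omega>
  proof -
    have "(\<Sum>c\<in>C. f c \<omega> * g c \<omega>) = (\<Sum>c\<in>C. if T \<omega> = c then g c \<omega> else 0)"
      by (intro sum.cong) (use that in \<open>auto simp: f_def\<close>)
    also have "\<dots> = g (T \<omega>) \<omega>" using C TC[OF that] by simp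
    finally show ?thesis using that by (auto simp: g_def indicator_def)
  qed
  have meas: "(\<lambda>\<omega>. \<Sum>c\<in>C. f c \<omega> * g c \<omega>) \<in> borel_measurable M"
    using fM g by (intro borel_measurable_sum borel_measurable_times) auto
  have "AE \<omega> in M. real_cond_exp M F (indicator {\<omega>\<in>space M. Z \<omega> \<in> D (T \<omega>)}) \<omega> =
      real_cond_exp M F (\<lambda>\<omega>. \<Sum>c\<in>C. f c \<omega> * g c \<omega>) \<omega>"
    by (rule real_cond_exp_cong) (use split meas in \<open>auto cong: measurable_cong\<close>)
  moreover have "AE \<omega> in M. real_cond_exp M F (\<lambda>\<omega>. \<Sum>c\<in>C. f c \<omega> * g c \<omega>) \<omega> =
      (\<Sum>c\<in>C. real_cond_exp M F (\<lambda>\<omega>. f c \<omega> * g c \<omega>) \<omega>)"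
    by (rule real_cond_exp_sum[OF int])
  \<comment> \<open>\<open>f c\<close> is \<open>F\<close>-measurable and pulls out of the
    conditional expectation; what remains is the conditional law of \<open>Z\<close> on the fixed
    set \<open>D c\<close>.\<close>
  moreover have "AE \<omega> in M. \<forall>c\<in>C. real_cond_exp M F (\<lambda>\<omega>. f c \<omega> * g c \<omega>) \<omega> = f c \<omega> * measure (\<kappa> \<omega>) (D c)"
  proof (rule AE_finite_allI[OF C])
    fix c assume c: "c \<in> C"
    have "AE \<omega> in M. measure (\<kappa> \<omega>) (D c) = real_cond_exp M F (g c) \<omega>"
      using law D[OF c] by (auto simp: regular_cond_law_def g_def)
    with real_cond_exp_mult[OF f[OF c] g[OF c] int]
    show "AE \<omega> in M. real_cond_exp M F (\<lambda>\<omega>. f c \<omega> * g c \<omega>) \<omega> = f c \<omega> * measure (\<kappa> \<omega>) (D c)"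
      by eventually_elim simp
  qed
  ultimately show ?thesis using AE_space
  proof eventually_elim
    case (elim \<omega>)
    have "(\<Sum>c\<in>C. f c \<omega> * measure (\<kappa> \<omega>) (D c)) = (\<Sum>c\<in>C. if T \<omega> = c then measure (\<kappa> \<omega>) (D c) else 0)"
      by (intro sum.cong) (use elim in \<open>auto simp: f_def\<close>)
    also have "\<dots> = measure (\<kappa> \<omega>) (D (T \<omega>))" using C TC elim by simp
    finally show ?case using elim by simp
  qed
qed

lemma
  assumes "regular_cond_law M F S Z \<kappa>"
  shows regular_cond_law_AE: "A \<in> sets S \<Longrightarrow>
      AE \<omega> in M. measure (\<kappa> \<omega>) A = real_cond_exp M F (indicator (Z -` A \<inter> space M)) \<omega>"
    and regular_cond_law_space: "\<omega> \<in> space F \<Longrightarrow> \<kappa> \<omega> \<in> space (prob_algebra S)"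
  using assms by (auto simp: regular_cond_law_def dest: measurable_space)

section \<open>Measurability of the observed stream\<close>

lemma batch_measurable:
  assumes X: "\<And>i r. i \<in> {1..N+1} \<Longrightarrow> r \<ge> 1 \<Longrightarrow> X i r \<in> borel_measurable M"
    and Y: "\<And>i r. i \<in> {1..N+1} \<Longrightarrow> r \<ge> 1 \<Longrightarrow> Y i r \<in> borel_measurable M"
    and R: "\<And>r. r \<ge> 1 \<Longrightarrow> R r \<in> borel_measurable M"
    and R_0: "\<And>\<omega>. \<omega> \<in> space M \<Longrightarrow> R 0 \<omega> = 0"
    and r: "r \<ge> 1"
  shows "batch N X Y R r \<in> M \<rightarrow>\<^sub>M batch_space N"
proof -
  \<comment> \<open>Round \<open>1\<close> reads index \<open>0\<close>, which the measurability
    hypotheses do not reach; there \<open>R 0\<close> and \<open>R 0 * Y (N+1) 0\<close> vanish on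
    \<open>space M\<close>.\<close>
  have R': "R q \<in> borel_measurable M" for q
    using R[of q] R_0 by (cases "q = 0") (auto cong: measurable_cong)
  have RY: "(\<lambda>\<omega>. R q \<omega> * Y (N+1) q \<omega>) \<in> borel_measurable M" for q
  proof (cases "q = 0")
    case True
    have "(\<lambda>\<omega>. R q \<omega> * Y (N+1) q \<omega>) \<in> borel_measurable M \<longleftrightarrow> (\<lambda>_. 0::real) \<in> borel_measurable M"
      by (rule measurable_cong) (simp add: True R_0)
    then show ?thesis by simp
  next
    case False
    then show ?thesis using R'[of q] Y[of "N+1" q] by simp
  qed
  show ?thesis unfolding batch_def batch_space_def
    by (intro measurable_Pair measurable_restrict X Y R' RY r) auto
qed

lemma space_info [simp]: "space (info M N X Y R n) = space M"
  by (simp add: info_def space_measure_of_conv)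

lemma space_info_plus [simp]: "space (info_plus M N X Y R n) = space M"
  by (simp add: info_plus_def space_measure_of_conv)

lemma sets_info:
  fixes X :: "nat \<Rightarrow> nat \<Rightarrow> 'a \<Rightarrow> real ^ ('d::finite)"
  shows "sets (info M N X Y R n) = sigma_sets (space M)
    (\<Union>r\<in>{1..n}. {batch N X Y R r -` A \<inter> space M | A. A \<in> sets (batch_space N :: 'd batch measure)})"
  unfolding info_def by (rule sets_measure_of) auto

lemma sets_info_plus:
  "sets (info_plus M N X Y R n) = sigma_sets (space M)
    (sets (info M N X Y R n) \<union>
     {(\<lambda>\<omega>. (R n \<omega>, R n \<omega> * Y (N+1) n \<omega>)) -` A \<inter> space M | A. A \<in> sets (borel \<Otimes>\<^sub>M borel)})"
  unfolding info_plus_def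
  by (rule sets_measure_of) (use sets.sets_into_space[of _ "info M N X Y R n"] in auto)

lemma batch_info_plus:
  fixes X :: "nat \<Rightarrow> nat \<Rightarrow> 'a \<Rightarrow> real ^ ('d::finite)"
  assumes r: "1 \<le> r" "r \<le> n"
  shows "batch N X Y R r \<in> info_plus M N X Y R n \<rightarrow>\<^sub>M batch_space N"
proof (rule measurableI)
  show "batch N X Y R r \<omega> \<in> space (batch_space N)" for \<omega>
    by (auto simp: batch_def batch_space_def space_pair_measure space_PiM)
  fix A :: "'d batch set" assume "A \<in> sets (batch_space N)"
  then have "batch N X Y R r -` A \<inter> space M \<in> sets (info M N X Y R n)"
    unfolding sets_info by (intro sigma_sets.Basic UN_I[of r]) (use r in auto)
  then show "batch N X Y R r -` A \<inter> space (info_plus M N X Y R n) \<in> sets (info_plus M N X Y R n)"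
    by (simp add: sets_info_plus sigma_sets.Basic)
qed

lemma revealed_info_plus:
  "(\<lambda>\<omega>. (R n \<omega>, R n \<omega> * Y (N+1) n \<omega>)) \<in> info_plus M N X Y R n \<rightarrow>\<^sub>M borel \<Otimes>\<^sub>M borel"
proof (rule measurableI)
  fix A :: "(real \<times> real) set" assume "A \<in> sets (borel \<Otimes>\<^sub>M borel)"
  then show "(\<lambda>\<omega>. (R n \<omega>, R n \<omega> * Y (N+1) n \<omega>)) -` A \<inter> space (info_plus M N X Y R n)
      \<in> sets (info_plus M N X Y R n)"
    unfolding sets_info_plus space_info_plus by (intro sigma_sets.Basic UnI2 CollectI exI[of _ A]) simp
qed (simp add: space_pair_measure)

lemma subalgebra_info_plus:
  assumes X: "\<And>i r. i \<in> {1..N+1} \<Longrightarrow> r \<ge> 1 \<Longrightarrow> X i r \<in> borel_measurable M"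
    and Y: "\<And>i r. i \<in> {1..N+1} \<Longrightarrow> r \<ge> 1 \<Longrightarrow> Y i r \<in> borel_measurable M"
    and R: "\<And>r. r \<ge> 1 \<Longrightarrow> R r \<in> borel_measurable M"
    and R_0: "\<And>\<omega>. \<omega> \<in> space M \<Longrightarrow> R 0 \<omega> = 0"
    and n: "n \<ge> 1"
  shows "subalgebra M (info_plus M N X Y R n)"
proof -
  have "sets (info M N X Y R n) \<subseteq> sets M"
    unfolding sets_info
    using measurable_sets[OF batch_measurable[of N X M Y R, OF X Y R R_0]]
    by (auto intro!: sets.sigma_sets_subset)
  moreover have "(\<lambda>\<omega>. (R n \<omega>, R n \<omega> * Y (N+1) n \<omega>)) \<in> M \<rightarrow>\<^sub>M borel \<Otimes>\<^sub>M borel"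
    using n R Y by (intro measurable_Pair borel_measurable_times) auto
  then have "(\<lambda>\<omega>. (R n \<omega>, R n \<omega> * Y (N+1) n \<omega>)) -` A \<inter> space M \<in> sets M"
    if "A \<in> sets (borel \<Otimes>\<^sub>M borel)" for A using that measurable_sets by blast
  ultimately show ?thesis
    unfolding subalgebra_def sets_info_plus by (auto intro!: sets.sigma_sets_subset)
qed

text \<open>The target's response is observed only through \<open>R r * Y (N+1) r\<close>, hence the
  smaller range \<open>{1..N}\<close> in the claim on \<open>Y\<close>.\<close>

lemma
  fixes X :: "nat \<Rightarrow> nat \<Rightarrow> 'a \<Rightarrow> real ^ ('d::finite)"
  assumes r: "1 \<le> r" "r \<le> n"
  shows covariate_info_plus: "i \<in> {1..N+1} \<Longrightarrow> X i r \<in> borel_measurable (info_plus M N X Y R n)"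
    and response_info_plus: "i \<in> {1..N} \<Longrightarrow> Y i r \<in> borel_measurable (info_plus M N X Y R n)"
    and indicator_info_plus: "R r \<in> borel_measurable (info_plus M N X Y R n)"
    and revealed_response_info_plus:
      "(\<lambda>\<omega>. R r \<omega> * Y (N+1) r \<omega>) \<in> borel_measurable (info_plus M N X Y R n)"
proof -
  let ?F = "info_plus M N X Y R n"
  have b: "batch N X Y R q \<in> ?F \<rightarrow>\<^sub>M (\<Pi>\<^sub>M i\<in>{1..N}. borel \<Otimes>\<^sub>M borel) \<Otimes>\<^sub>M borel \<Otimes>\<^sub>M borel \<Otimes>\<^sub>M borel"
    if "1 \<le> q" "q \<le> n" for q
    using batch_info_plus[OF that] unfolding batch_space_def .
  have XY: "(\<lambda>\<omega>. (X i r \<omega>, Y i r \<omega>)) \<in> ?F \<rightarrow>\<^sub>M borel \<Otimes>\<^sub>M borel" if "i \<in> {1..N}" for i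
    using measurable_compose[OF b[OF r] measurable_compose[OF measurable_fst measurable_component_singleton[OF that]]] that
    by (simp add: batch_def)
  show "Y i r \<in> borel_measurable ?F" if "i \<in> {1..N}" for i
    using measurable_compose[OF XY[OF that] measurable_snd] by simp
  show "X i r \<in> borel_measurable ?F" if i: "i \<in> {1..N+1}"
  proof (cases "i = N+1")
    case True
    then show ?thesis
      using measurable_compose[OF b[OF r] measurable_compose[OF measurable_snd measurable_fst]]
      by (simp add: batch_def)
  next
    case False
    then show ?thesis using measurable_compose[OF XY measurable_fst, of i] i by simp
  qed
  \<comment> \<open>The pair of round \<open>r\<close> is reported in the batch of round
    \<open>r + 1\<close>. For \<open>r = n\<close> that batch is not yet included, and the pair is
    exactly what \<open>info_plus\<close> adds to \<open>info\<close>.\<close>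
  have "(\<lambda>\<omega>. (R r \<omega>, R r \<omega> * Y (N+1) r \<omega>)) \<in> ?F \<rightarrow>\<^sub>M borel \<Otimes>\<^sub>M borel"
  proof (cases "r = n")
    case True
    then show ?thesis using revealed_info_plus by simp
  next
    case False
    then show ?thesis
      using measurable_compose[OF b[of "Suc r"] measurable_compose[OF measurable_snd measurable_snd]] r
      by (simp add: batch_def)
  qed
  from measurable_compose[OF this measurable_fst] measurable_compose[OF this measurable_snd]
  show "R r \<in> borel_measurable ?F" "(\<lambda>\<omega>. R r \<omega> * Y (N+1) r \<omega>) \<in> borel_measurable ?F" by simp_all
qed

subsection \<open>Weights and levels\<close>

lemma affinity_bounds: "0 < affinity N h X k t \<omega>" "affinity N h X k t \<omega> \<le> 1"
  by (auto simp: affinity_def)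

lemma sum_affinity_pos: "0 < (\<Sum>j=1..N+1. affinity N h X j t \<omega>)"
  by (rule sum_pos) (auto simp: affinity_bounds)

lemma weight_nonneg: "0 \<le> weight N h X t k \<omega>"
  using sum_affinity_pos[of N h X "t - 1" \<omega>] less_imp_le[OF affinity_bounds(1)[of N h X k "t - 1" \<omega>]]
  by (cases "t \<le> 1") (simp_all add: weight_def)

lemma sum_weight: "(\<Sum>k=1..N+1. weight N h X t k \<omega>) = 1"
proof (cases "t \<le> 1")
  case True
  then show ?thesis by (simp add: weight_def)
next
  case False
  then show ?thesis
    using sum_affinity_pos[of N h X "t - 1" \<omega>] by (simp add: weight_def flip: sum_divide_distrib)
qed

text \<open>The target's affinity \<open>1\<close> is the largest possible. This is the condition
  under which a swap loses no weight in \<open>exceed_swap\<close>.\<close>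

lemma weight_le_target: "weight N h X t k \<omega> \<le> weight N h X t (N+1) \<omega>"
proof -
  have "affinity N h X k (t - 1) \<omega> \<le> affinity N h X (N+1) (t - 1) \<omega>"
    using affinity_bounds(2) by (simp add: affinity_def[of N h X "Suc N"])
  then show ?thesis
    using sum_affinity_pos[of N h X "t - 1" \<omega>]
    by (cases "t \<le> 1") (simp_all add: weight_def divide_right_mono)
qed

text \<open>The target enters the quantile with score \<open>\<infinity>\<close>, which is never
  strictly below a real score, so only units \<open>1\<close> to \<open>N\<close> are counted. The
  finite sum also serves to show that the level is measurable.\<close>

lemma not_in_pred_set_at_iff:
  "y \<notin> pred_set_at N h s X Y a t \<omega> \<longleftrightarrow>
    1 - a \<le> sum (\<lambda>k. weight N h X t k \<omega>) {k\<in>{1..N}. s (X k t \<omega>, Y k t \<omega>) < s (X (N+1) t \<omega>, y)}"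
proof -
  let ?v = "\<lambda>k. if k \<le> N then ereal (s (X k t \<omega>, Y k t \<omega>)) else \<infinity>"
  have "{k\<in>{1..N+1}. ?v k < ereal (s (X (N+1) t \<omega>, y))} =
      {k\<in>{1..N}. s (X k t \<omega>, Y k t \<omega>) < s (X (N+1) t \<omega>, y)}"
    by auto
  then show ?thesis
    using weighted_quantile_less_iff[of "N+1" "\<lambda>k. weight N h X t k \<omega>" "ereal (s (X (N+1) t \<omega>, y))" ?v "1 - a"]
    by (simp add: pred_set_at_def threshold_at_def not_le weight_nonneg)
qed

text \<open>The procedure gives the target the score \<open>\<infinity>\<close>,
  \<open>exceed\<close> gives it its true score; either way the target is not strictly below itself,
  so the counted units agree.\<close>

lemma miscoverage_iff_exceed:
  assumes "score_vec N s X Y t \<omega> \<in> space (score_space N)"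
  shows "Y (N+1) t \<omega> \<notin> pred_set_at N h s X Y a t \<omega> \<longleftrightarrow>
    score_vec N s X Y t \<omega> \<in> exceed N (heavy N (\<lambda>k. weight N h X t k \<omega>) a) (N+1)"
proof -
  have "{j\<in>{1..N+1}. score_vec N s X Y t \<omega> j < score_vec N s X Y t \<omega> (N+1)} =
      {k\<in>{1..N}. s (X k t \<omega>, Y k t \<omega>) < s (X (N+1) t \<omega>, Y (N+1) t \<omega>)}"
    by (auto simp: score_vec_def le_Suc_eq)
  moreover have "{k\<in>{1..N}. s (X k t \<omega>, Y k t \<omega>) < s (X (N+1) t \<omega>, Y (N+1) t \<omega>)} \<subseteq> {1..N+1}"
    by auto
  ultimately show ?thesis using assms
    unfolding not_in_pred_set_at_iff exceed_def heavy_def by simp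
qed

section \<open>Predictability of the weights and levels\<close>

lemma mean_profile_info_plus:
  fixes X :: "nat \<Rightarrow> nat \<Rightarrow> 'a \<Rightarrow> real ^ ('d::finite)"
  assumes "k \<in> {1..N+1}" "r \<le> n"
  shows "mean_profile X k r \<in> borel_measurable (info_plus M N X Y R n)"
proof -
  have "X k q \<in> borel_measurable (info_plus M N X Y R n)" if "q \<in> {1..r}" for q
    by (rule covariate_info_plus) (use assms that in auto)
  then show ?thesis
    unfolding mean_profile_def
    by (intro borel_measurable_scaleR borel_measurable_const borel_measurable_sum)
qed

text \<open>Weights of round \<open>r\<close> use profiles up to round \<open>r - 1\<close> only,
  which explains the bound \<open>r \<le> n + 1\<close>.\<close>

lemma weight_info_plus:
  fixes X :: "nat \<Rightarrow> nat \<Rightarrow> 'a \<Rightarrow> real ^ ('d::finite)"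
  assumes k: "k \<in> {1..N+1}" and r: "r \<le> n + 1"
  shows "weight N h X r k \<in> borel_measurable (info_plus M N X Y R n)"
proof -
  have *: "affinity N h X j (r - 1) \<in> borel_measurable (info_plus M N X Y R n)" if "j \<in> {1..N+1}" for j
  proof -
    have [measurable]: "mean_profile X i (r - 1) \<in> borel_measurable (info_plus M N X Y R n)"
      if "i \<in> {1..N+1}" for i
      using that r by (intro mean_profile_info_plus) auto
    note [measurable] = this[OF that] this[of "N+1", simplified]
    show ?thesis unfolding affinity_def by measurable
  qed
  have "(\<lambda>\<omega>. \<Sum>j=1..N+1. affinity N h X j (r - 1) \<omega>) \<in> borel_measurable (info_plus M N X Y R n)"
    using * by (rule borel_measurable_sum)
  then show ?thesis
    using borel_measurable_divide[OF *[OF k]] by (cases "r \<le> 1") (simp_all add: weight_def[abs_def])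
qed

text \<open>The level reads \<open>Y (N+1) r\<close> only in rounds with \<open>R r = 1\<close>, where it equals the observed
  \<open>R r * Y (N+1) r\<close>.\<close>

lemma level_info_plus:
  fixes X :: "nat \<Rightarrow> nat \<Rightarrow> 'a \<Rightarrow> real ^ ('d::finite)"
  assumes s: "s \<in> borel_measurable (borel \<Otimes>\<^sub>M borel)"
    and R_0: "\<And>\<omega>. \<omega> \<in> space M \<Longrightarrow> R 0 \<omega> = 0"
    and "r \<le> n + 1"
  shows "level N \<alpha> h \<gamma> s X Y R r \<in> borel_measurable (info_plus M N X Y R n)"
  using \<open>r \<le> n + 1\<close>
proof (induction r)
  case (Suc r)
  let ?F = "info_plus M N X Y R n" and ?l = "level N \<alpha> h \<gamma> s X Y R r"
  have l [measurable]: "?l \<in> borel_measurable ?F" using Suc by simp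
  show ?case
  proof (cases "r = 0")
    \<comment> \<open>Passing from index \<open>0\<close> to round \<open>1\<close> updates nothing,
      since \<open>R 0 = 0\<close>.\<close>
    case True
    have "level N \<alpha> h \<gamma> s X Y R (Suc r) \<in> borel_measurable ?F \<longleftrightarrow> ?l \<in> borel_measurable ?F"
      by (rule measurable_cong) (simp add: True R_0)
    then show ?thesis using l by (rule iffD2)
  next
    case False
    then have r: "1 \<le> r" "r \<le> n" using Suc by auto
    let ?y = "\<lambda>\<omega>. R r \<omega> * Y (N+1) r \<omega>"
    let ?p = "\<lambda>\<omega>. 1 - ?l \<omega> \<le> (\<Sum>k=1..N. weight N h X r k \<omega> *
      of_bool (s (X k r \<omega>, Y k r \<omega>) < s (X (N+1) r \<omega>, ?y \<omega>)))"
    have step: "(\<lambda>\<omega>. if b \<omega> = 1 then l \<omega> + \<gamma> * (\<alpha> - of_bool (1 - l \<omega> \<le> S \<omega>)) else l \<omega>) \<in> borel_measurable F"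
      if [measurable]: "l \<in> borel_measurable F" "b \<in> borel_measurable F" "S \<in> borel_measurable F"
      for F and l b S :: "'a \<Rightarrow> real"
      by measurable
    have s1: "(\<lambda>\<omega>. s (X k r \<omega>, Y k r \<omega>)) \<in> borel_measurable ?F" if "k \<in> {1..N}" for k
    proof (rule measurable_compose[OF _ s], rule measurable_Pair)
      show "X k r \<in> borel_measurable ?F" using that by (intro covariate_info_plus[OF r]) auto
      show "Y k r \<in> borel_measurable ?F" by (rule response_info_plus[OF r that])
    qed
    have s2: "(\<lambda>\<omega>. s (X (N+1) r \<omega>, ?y \<omega>)) \<in> borel_measurable ?F"
    proof (rule measurable_compose[OF _ s], rule measurable_Pair)
      show "X (N+1) r \<in> borel_measurable ?F" by (intro covariate_info_plus[OF r]) auto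
      show "?y \<in> borel_measurable ?F" by (rule revealed_response_info_plus[OF r])
    qed
    have w: "weight N h X r k \<in> borel_measurable ?F" if "k \<in> {1..N}" for k
      using that r by (intro weight_info_plus) auto
    have sum: "(\<lambda>\<omega>. \<Sum>k=1..N. weight N h X r k \<omega> *
        of_bool (s (X k r \<omega>, Y k r \<omega>) < s (X (N+1) r \<omega>, ?y \<omega>))) \<in> borel_measurable ?F"
    proof (rule borel_measurable_sum)
      fix k assume k: "k \<in> {1..N}"
      note [measurable] = s1[OF k] s2 w[OF k]
      show "(\<lambda>\<omega>. weight N h X r k \<omega> *
        of_bool (s (X k r \<omega>, Y k r \<omega>) < s (X (N+1) r \<omega>, ?y \<omega>))) \<in> borel_measurable ?F"
        by measurable
    qed
    have p: "?p \<omega> \<longleftrightarrow> ?y \<omega> \<notin> pred_set_at N h s X Y (?l \<omega>) r \<omega>" for \<omega>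
      unfolding not_in_pred_set_at_iff sum_mult_of_bool[OF finite_atLeastAtMost] ..
    have "level N \<alpha> h \<gamma> s X Y R (Suc r) =
        (\<lambda>\<omega>. if R r \<omega> = 1 then ?l \<omega> + \<gamma> * (\<alpha> - of_bool (?p \<omega>)) else ?l \<omega>)"
      unfolding p by (simp add: fun_eq_iff)
    also have "\<dots> \<in> borel_measurable ?F"
      using l indicator_info_plus[OF r] sum by (rule step)
    finally show ?thesis .
  qed
qed simp

subsection \<open>Perturbation of the weights\<close>

text \<open>For \<open>0 \<le> u \<le> v\<close>, the factor \<open>exp (- u)\<close> is at most
  \<open>1\<close>, and \<open>1 + z \<le> exp z\<close> at \<open>z = u - v\<close> bounds the
  rest.\<close>

lemma abs_exp_minus_diff_le:
  fixes x y :: real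
  assumes "0 \<le> x" "0 \<le> y"
  shows "\<bar>exp (- x) - exp (- y)\<bar> \<le> \<bar>x - y\<bar>"
proof -
  have *: "exp (- u) - exp (- v) \<le> v - u" if "0 \<le> u" "u \<le> v" for u v :: real
  proof -
    have "exp (- u) - exp (- v) = exp (- u) * (1 - exp (u - v))"
      by (simp add: algebra_simps flip: exp_add)
    also have "\<dots> \<le> 1 * (1 - exp (u - v))" using that by (intro mult_right_mono) auto
    also have "\<dots> \<le> v - u"
      using le_diff_eq[of "1 - (v - u)"] exp_ge_add_one_self[of "u - v"] by argo
    finally show ?thesis .
  qed
  show ?thesis using *[of x y] *[of y x] assms by (cases "x \<le> y") auto
qed

text \<open>The summand \<open>1\<close>, in the application the target's affinity, keeps both
  normalizers at least \<open>1\<close>. Changing the numerators costs at most \<open>e\<close> and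
  changing the normalizer at most another \<open>e\<close>, hence the factor
  \<open>2\<close>.\<close>

lemma sum_abs_normalized_diff_le:
  fixes a b :: "'i \<Rightarrow> real"
  assumes a: "\<And>k. k \<in> I \<Longrightarrow> 0 \<le> a k" and b: "\<And>k. k \<in> I \<Longrightarrow> 0 \<le> b k"
    and diff: "\<And>k. k \<in> I \<Longrightarrow> \<bar>a k - b k\<bar> \<le> \<eta>"
  shows "(\<Sum>k\<in>I. \<bar>a k / (1 + sum a I) - b k / (1 + sum b I)\<bar>) \<le> 2 * real (card I) * \<eta>"
proof -
  define A B e where "A = 1 + sum a I" and "B = 1 + sum b I" and "e = (\<Sum>k\<in>I. \<bar>a k - b k\<bar>)"
  have AB: "1 \<le> A" "1 \<le> B" unfolding A_def B_def using a b by (auto intro: sum_nonneg)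
  have e: "0 \<le> e" "e \<le> real (card I) * \<eta>"
    unfolding e_def using diff sum_bounded_above[of I "\<lambda>k. \<bar>a k - b k\<bar>" \<eta>] by (auto intro: sum_nonneg)
  have BA: "\<bar>B - A\<bar> \<le> e"
    unfolding A_def B_def e_def using sum_abs[of "\<lambda>k. a k - b k" I] by (simp add: sum_subtractf)
  have term_le: "\<bar>a k / A - b k / B\<bar> \<le> \<bar>a k - b k\<bar> + b k / B * e" if k: "k \<in> I" for k
  proof -
    \<comment> \<open>The numerator is changed first, then the normalizer; the fractions
      \<open>b k / B\<close> sum to at most \<open>1\<close>.\<close>
    have "a k / A - b k / B = (a k - b k) / A + b k / B * ((B - A) / A)"
      using AB by (simp add: field_simps)
    also have "\<bar>\<dots>\<bar> \<le> \<bar>a k - b k\<bar> / A + b k / B * (\<bar>B - A\<bar> / A)"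
      using AB b[OF k] by (intro order_trans[OF abs_triangle_ineq]) (simp add: abs_mult)
    also have "\<dots> \<le> \<bar>a k - b k\<bar> / 1 + b k / B * (e / 1)"
      using AB b[OF k] BA by (intro add_mono mult_left_mono frac_le) auto
    finally show ?thesis by simp
  qed
  have "(\<Sum>k\<in>I. \<bar>a k / A - b k / B\<bar>) \<le> (\<Sum>k\<in>I. \<bar>a k - b k\<bar> + b k / B * e)"
    using term_le by (rule sum_mono)
  also have "\<dots> = e + sum b I / B * e"
    by (simp add: sum.distrib e_def flip: sum_distrib_right sum_divide_distrib)
  also have "\<dots> \<le> e + 1 * e"
    using AB e by (intro add_left_mono mult_right_mono) (auto simp: B_def)
  finally show ?thesis using e by (simp add: A_def B_def)
qed

lemma abs_norm_power2_diff_le: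
  fixes x y :: "'v::real_normed_vector"
  assumes "norm (x - y) \<le> d" "norm y \<le> D"
  shows "\<bar>(norm x)\<^sup>2 - (norm y)\<^sup>2\<bar> \<le> d * (2 * D + d)"
proof -
  have 1: "\<bar>norm x - norm y\<bar> \<le> d" using norm_triangle_ineq3[of x y] assms(1) by simp
  then have 2: "norm x + norm y \<le> 2 * D + d" using assms(2) by linarith
  have "\<bar>(norm x)\<^sup>2 - (norm y)\<^sup>2\<bar> = \<bar>norm x - norm y\<bar> * (norm x + norm y)"
    by (simp add: power2_eq_square square_diff_square_factored abs_mult mult.commute)
  also have "\<dots> \<le> d * (2 * D + d)" using 1 2 by (intro mult_mono) auto
  finally show ?thesis .
qed

text \<open>Two profiles, each off by \<open>e\<close>, give a difference off by
  \<open>2 * e\<close>, so the squared norms differ by at most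
  \<open>2 * e * (2 * max_gap N \<mu> + 2 * e)\<close>. Dividing by \<open>2 * h\<^sup>2\<close>
  gives \<open>\<eta>\<close>, and normalization contributes the factor
  \<open>2 * N\<close>.\<close>

lemma sum_abs_weight_diff_le:
  fixes X :: "nat \<Rightarrow> nat \<Rightarrow> 'a \<Rightarrow> real ^ ('d::finite)"
  assumes t: "t \<ge> 2" and h: "h > 0"
    and close: "\<And>k. k \<in> {1..N+1} \<Longrightarrow> norm (mean_profile X k (t - 1) \<omega> - \<mu> k) \<le> e"
  shows "(\<Sum>k=1..N. \<bar>weight N h X t k \<omega> - oracle_weight N h \<mu> k\<bar>) \<le>
    4 * real N / h\<^sup>2 * (max_gap N \<mu> * e + e\<^sup>2)"
proof -
  define a where "a k = affinity N h X k (t - 1) \<omega>" for k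
  define b where "b k = exp (- (profile_gap N \<mu> k)\<^sup>2 / (2 * h\<^sup>2))" for k
  define \<eta> where "\<eta> = 2 / h\<^sup>2 * (max_gap N \<mu> * e + e\<^sup>2)"
  have diff: "\<bar>a k - b k\<bar> \<le> \<eta>" if k: "k \<in> {1..N}" for k
  proof -
    define x where "x = mean_profile X k (t - 1) \<omega> - mean_profile X (N+1) (t - 1) \<omega>"
    define y where "y = \<mu> k - \<mu> (N+1)"
    have "x - y = (mean_profile X k (t - 1) \<omega> - \<mu> k) - (mean_profile X (N+1) (t - 1) \<omega> - \<mu> (N+1))"
      by (simp add: x_def y_def)
    then have "norm (x - y) \<le> 2 * e"
      using norm_triangle_ineq4[of "mean_profile X k (t - 1) \<omega> - \<mu> k"
        "mean_profile X (N+1) (t - 1) \<omega> - \<mu> (N+1)"] close[of k] close[of "N+1"] k by simp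
    moreover have "norm y \<le> max_gap N \<mu>"
      unfolding max_gap_def using k by (intro Max_ge) (auto simp: profile_gap_def y_def)
    ultimately have sq: "\<bar>(norm x)\<^sup>2 - (norm y)\<^sup>2\<bar> \<le> 2 * e * (2 * max_gap N \<mu> + 2 * e)"
      by (rule abs_norm_power2_diff_le)
    have "\<bar>a k - b k\<bar> \<le> \<bar>(norm x)\<^sup>2 / (2 * h\<^sup>2) - (norm y)\<^sup>2 / (2 * h\<^sup>2)\<bar>"
      using abs_exp_minus_diff_le[of "(norm x)\<^sup>2 / (2 * h\<^sup>2)" "(norm y)\<^sup>2 / (2 * h\<^sup>2)"] k
      by (simp add: a_def b_def affinity_def profile_gap_def x_def y_def)
    also have "\<dots> = \<bar>(norm x)\<^sup>2 - (norm y)\<^sup>2\<bar> / (2 * h\<^sup>2)"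
      using h by (simp add: abs_divide flip: diff_divide_distrib)
    also have "\<dots> \<le> 2 * e * (2 * max_gap N \<mu> + 2 * e) / (2 * h\<^sup>2)"
      using sq by (intro divide_right_mono) auto
    also have "\<dots> = \<eta>" using h by (simp add: \<eta>_def field_simps power2_eq_square)
    finally show ?thesis .
  qed
  have "(\<Sum>j=1..N+1. affinity N h X j (t - 1) \<omega>) = 1 + sum a {1..N}"
    by (simp add: a_def affinity_def[of N h X "Suc N"])
  then have "(\<Sum>k=1..N. \<bar>weight N h X t k \<omega> - oracle_weight N h \<mu> k\<bar>) =
      (\<Sum>k=1..N. \<bar>a k / (1 + sum a {1..N}) - b k / (1 + sum b {1..N})\<bar>)"
    using t by (simp add: weight_def oracle_weight_def a_def b_def add.commute[of 1])
  also have "\<dots> \<le> 2 * real (card {1..N}) * \<eta>"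
    by (rule sum_abs_normalized_diff_le[OF _ _ diff]) (auto simp: a_def b_def affinity_def)
  finally show ?thesis by (simp add: \<eta>_def algebra_simps add_divide_distrib)
qed

subsection \<open>Conditional coverage\<close>

theorem theorem5p3:
  fixes M :: "'a measure"
    and N t :: nat
    and X :: "nat \<Rightarrow> nat \<Rightarrow> 'a \<Rightarrow> real ^ ('d::finite)"
    and Y :: "nat \<Rightarrow> nat \<Rightarrow> 'a \<Rightarrow> real"
    and R :: "nat \<Rightarrow> 'a \<Rightarrow> real"
    and s :: "(real ^ 'd) \<times> real \<Rightarrow> real"
    and \<alpha> h \<gamma> :: real
    and P :: "nat \<Rightarrow> 'a \<Rightarrow> (nat \<Rightarrow> real) measure"
    and Pswap :: "nat \<Rightarrow> nat \<Rightarrow> 'a \<Rightarrow> (nat \<Rightarrow> real) measure"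
    and \<mu> :: "nat \<Rightarrow> real ^ 'd"
    and \<epsilon> :: "nat \<Rightarrow> real \<Rightarrow> real"
    and \<phi> :: "real \<Rightarrow> real"
  assumes "prob_space M"
    and "N \<ge> 1"
    and X_meas: "\<And>i r. i \<in> {1..N+1} \<Longrightarrow> r \<ge> 1 \<Longrightarrow> X i r \<in> borel_measurable M"
    and Y_meas: "\<And>i r. i \<in> {1..N+1} \<Longrightarrow> r \<ge> 1 \<Longrightarrow> Y i r \<in> borel_measurable M"
    and R_meas: "\<And>r. r \<ge> 1 \<Longrightarrow> R r \<in> borel_measurable M"
    and R_range: "\<And>r \<omega>. r \<ge> 1 \<Longrightarrow> \<omega> \<in> space M \<Longrightarrow> R r \<omega> \<in> {0, 1}"
    and R_0: "\<And>\<omega>. \<omega> \<in> space M \<Longrightarrow> R 0 \<omega> = 0"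
    and Y_0: "\<And>\<omega>. \<omega> \<in> space M \<Longrightarrow> Y (N+1) 0 \<omega> = 0"
    and s_meas: "s \<in> borel_measurable (borel \<Otimes>\<^sub>M borel)"
    and "\<alpha> \<in> {0..1}" and "h > 0" and "\<gamma> > 0"
    and P_law: "\<And>r. r \<ge> 1 \<Longrightarrow>
      regular_cond_law M (info_plus M N X Y R (r - 1)) (score_space N)
        (score_vec N s X Y r) (P r)"
    and Pswap_law: "\<And>r k. r \<ge> 1 \<Longrightarrow> k \<in> {1..N} \<Longrightarrow>
      regular_cond_law M (info_plus M N X Y R (r - 1)) (score_space N)
        (\<lambda>\<omega>. swap_coords k (N+1) (score_vec N s X Y r \<omega>)) (Pswap r k)"
    and eps_nonneg: "\<And>r \<delta>. r \<ge> 2 \<Longrightarrow> \<delta> \<in> {0<..<1} \<Longrightarrow> \<epsilon> r \<delta> \<ge> 0"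
    and learnability: "\<And>r \<delta>. r \<ge> 2 \<Longrightarrow> \<delta> \<in> {0<..<1} \<Longrightarrow>
      measure M {\<omega> \<in> space M.
        (MAX k\<in>{1..N+1}. norm (mean_profile X k (r - 1) \<omega> - \<mu> k)) \<le> \<epsilon> r \<delta>} \<ge> 1 - \<delta>"
    and phi_mono: "mono_on {0..} \<phi>"
    and phi_range: "\<phi> \<in> {0..} \<rightarrow> {0..1}"
    and tv_control: "\<And>r k. r \<ge> 1 \<Longrightarrow> k \<in> {1..N} \<Longrightarrow>
      AE \<omega> in M. tv_dist (P r \<omega>) (Pswap r k \<omega>) \<le> \<phi> (profile_gap N \<mu> k)"
    and "t \<ge> 2"
  shows "\<forall>\<delta>\<in>{0<..<1}. \<exists>E\<in>sets M. measure M E \<ge> 1 - \<delta> \<and>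
    (AE \<omega> in M. \<omega> \<in> E \<longrightarrow>
      real_cond_exp M (info_plus M N X Y R (t - 1))
        (indicator {\<omega> \<in> space M. Y (N+1) t \<omega> \<notin> pred_set N \<alpha> h \<gamma> s X Y R t \<omega>}) \<omega>
      \<le> min 1 (max 0 (level N \<alpha> h \<gamma> s X Y R t \<omega>))
        + (\<Sum>k=1..N. oracle_weight N h \<mu> k * \<phi> (profile_gap N \<mu> k))
        + 8 * real N * max_phi N \<phi> \<mu> / h\<^sup>2 *
            (max_gap N \<mu> * \<epsilon> t \<delta> + (\<epsilon> t \<delta>)\<^sup>2))"
proof
  fix \<delta> :: real assume \<delta>: "\<delta> \<in> {0<..<1}"
  interpret prob_space M by fact
  let ?F = "info_plus M N X Y R (t - 1)" and ?Z = "score_vec N s X Y t" and ?S = "score_space N"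
  let ?w = "\<lambda>\<omega> k. weight N h X t k \<omega>" and ?a = "level N \<alpha> h \<gamma> s X Y R t"
  let ?gap = "profile_gap N \<mu>"
  \<comment> \<open>The random family through which the past enters: finitely many values, and
    determined by \<open>?F\<close>.\<close>
  define T where "T \<omega> = heavy N (?w \<omega>) (?a \<omega>)" for \<omega>
  \<comment> \<open>By \<open>t \<ge> 2\<close> the index \<open>t - 1\<close> is a genuine round,
    so the generators of \<open>?F\<close> are measurable in \<open>M\<close>.\<close>
  have t: "t \<ge> 1" "t - 1 \<ge> 1" using \<open>t \<ge> 2\<close> by auto
  have sub: "subalgebra M ?F"
    using X_meas Y_meas R_meas R_0 t(2) by (rule subalgebra_info_plus)

  have Z: "?Z \<in> M \<rightarrow>\<^sub>M ?S"
    unfolding score_vec_def score_space_def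
    by (intro measurable_restrict measurable_compose[OF _ s_meas] measurable_Pair X_meas Y_meas t)
  have T: "T \<in> ?F \<rightarrow>\<^sub>M count_space (Pow (Pow {1..N+1}))"
  proof (subst measurable_count_space_eq2, simp, intro conjI ballI)
    show "T \<in> space ?F \<rightarrow> Pow (Pow {1..N+1})" unfolding T_def heavy_def by blast
    fix H assume H: "H \<in> Pow (Pow {1..N+1})"
    have "{\<omega> \<in> space ?F. \<forall>J\<in>Pow {1..N+1}. 1 - ?a \<omega> \<le> sum (?w \<omega>) J \<longleftrightarrow> J \<in> H} \<in> sets ?F"
    proof (rule sets.sets_Collect_finite_All')
      fix J assume J: "J \<in> Pow {1..N+1}"
      have "(\<lambda>\<omega>. 1 - ?a \<omega>) \<in> borel_measurable ?F"
        using s_meas R_0 t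
        by (intro borel_measurable_diff borel_measurable_const level_info_plus) auto
      moreover have "(\<lambda>\<omega>. sum (?w \<omega>) J) \<in> borel_measurable ?F"
        using t J by (intro borel_measurable_sum weight_info_plus) auto
      ultimately have "{\<omega> \<in> space ?F. 1 - ?a \<omega> \<le> sum (?w \<omega>) J} \<in> sets ?F"
        by (rule borel_measurable_le)
      then show "{\<omega> \<in> space ?F. 1 - ?a \<omega> \<le> sum (?w \<omega>) J \<longleftrightarrow> J \<in> H} \<in> sets ?F"
        by (cases "J \<in> H") (simp_all add: sets.sets_Collect_neg del: not_le space_info_plus)
    qed auto
    also have "{\<omega> \<in> space ?F. \<forall>J\<in>Pow {1..N+1}. 1 - ?a \<omega> \<le> sum (?w \<omega>) J \<longleftrightarrow> J \<in> H} =
        T -` {H} \<inter> space ?F"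
    proof -
      have "T \<omega> = H \<longleftrightarrow> (\<forall>J\<in>Pow {1..N+1}. 1 - ?a \<omega> \<le> sum (?w \<omega>) J \<longleftrightarrow> J \<in> H)" for \<omega>
        unfolding T_def using H by (intro heavy_eq_iff) simp
      then show ?thesis by blast
    qed
    finally show "T -` {H} \<inter> space ?F \<in> sets ?F" .
  qed

  have "Y (N+1) t \<omega> \<notin> pred_set N \<alpha> h \<gamma> s X Y R t \<omega> \<longleftrightarrow> ?Z \<omega> \<in> exceed N (T \<omega>) (N+1)"
    if "\<omega> \<in> space M" for \<omega>
    unfolding pred_set_def T_def by (rule miscoverage_iff_exceed[OF measurable_space[OF Z that]])
  then have eq: "{\<omega> \<in> space M. Y (N+1) t \<omega> \<notin> pred_set N \<alpha> h \<gamma> s X Y R t \<omega>} =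
      {\<omega> \<in> space M. ?Z \<omega> \<in> exceed N (T \<omega>) (N+1)}"
    by (intro Collect_cong conj_cong refl)
  have risk: "AE \<omega> in M. real_cond_exp M ?F
      (indicator {\<omega> \<in> space M. Y (N+1) t \<omega> \<notin> pred_set N \<alpha> h \<gamma> s X Y R t \<omega>}) \<omega> =
      measure (P t \<omega>) (exceed N (T \<omega>) (N+1))"
    unfolding eq
  proof (rule real_cond_exp_finite_param[OF \<open>prob_space M\<close> sub P_law[OF t(1)] Z _ T])
    show "exceed N H (N+1) \<in> sets ?S" for H by (rule exceed_sets) simp
  qed simp
  \<comment> \<open>For each fixed event both sides are versions of the same conditional
    probability. Finitely many \<open>k\<close> and \<open>H\<close> leave one common null set, so
    \<open>H\<close> may afterwards depend on the outcome.\<close>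
  have swap: "AE \<omega> in M. \<forall>k\<in>{1..N}. \<forall>H\<in>Pow (Pow {1..N+1}).
      measure (Pswap t k \<omega>) (exceed N H k) =
      measure (P t \<omega>) (swap_coords k (N+1) -` exceed N H k \<inter> space ?S)"
  proof (intro AE_finite_allI)
    fix k H assume k: "k \<in> {1..N}"
    let ?D = "exceed N H k" and ?D' = "swap_coords k (N+1) -` exceed N H k \<inter> space ?S"
    have "k \<in> {1..N+1}" using k by simp
    then have D: "?D \<in> sets ?S" "?D' \<in> sets ?S"
      by (rule exceed_sets, intro measurable_sets[OF swap_coords_measurable] exceed_sets)
    have "(\<lambda>\<omega>. swap_coords k (N+1) (?Z \<omega>)) -` ?D \<inter> space M = ?Z -` ?D' \<inter> space M"
      using measurable_space[OF Z] by auto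
    then have "AE \<omega> in M. measure (Pswap t k \<omega>) ?D = real_cond_exp M ?F (indicator (?Z -` ?D' \<inter> space M)) \<omega>"
      using regular_cond_law_AE[OF Pswap_law[OF t(1) k] D(1)] by simp
    moreover have "AE \<omega> in M. measure (P t \<omega>) ?D' = real_cond_exp M ?F (indicator (?Z -` ?D' \<inter> space M)) \<omega>"
      by (rule regular_cond_law_AE[OF P_law[OF t(1)] D(2)])
    ultimately show "AE \<omega> in M. measure (Pswap t k \<omega>) ?D = measure (P t \<omega>) ?D'"
      by eventually_elim simp
  qed auto
  have tv: "AE \<omega> in M. \<forall>k\<in>{1..N}. tv_dist (P t \<omega>) (Pswap t k \<omega>) \<le> \<phi> (?gap k)"
    using tv_control[OF t(1)] by (intro AE_finite_allI) auto

  \<comment> \<open>Learnability is used at the single round \<open>r = t\<close>. The good event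
    only controls the weights; the remaining bounds hold almost surely.\<close>
  define E where "E = {\<omega> \<in> space M.
    (MAX k\<in>{1..N+1}. norm (mean_profile X k (t - 1) \<omega> - \<mu> k)) \<le> \<epsilon> t \<delta>}"
  have "mean_profile X k (t - 1) \<in> borel_measurable M" if "k \<in> {1..N+1}" for k
    by (rule measurable_from_subalg[OF sub mean_profile_info_plus]) (use that in auto)
  then have "E \<in> sets M" unfolding E_def
    by (intro borel_measurable_le borel_measurable_Max borel_measurable_const
        borel_measurable_norm borel_measurable_diff) auto
  moreover have "measure M E \<ge> 1 - \<delta>"
    unfolding E_def using learnability[OF \<open>t \<ge> 2\<close> \<delta>] .
  moreover have "AE \<omega> in M. \<omega> \<in> E \<longrightarrow>
      real_cond_exp M ?F
        (indicator {\<omega> \<in> space M. Y (N+1) t \<omega> \<notin> pred_set N \<alpha> h \<gamma> s X Y R t \<omega>}) \<omega>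
      \<le> min 1 (max 0 (?a \<omega>)) + (\<Sum>k=1..N. oracle_weight N h \<mu> k * \<phi> (?gap k))
        + 8 * real N * max_phi N \<phi> \<mu> / h\<^sup>2 * (max_gap N \<mu> * \<epsilon> t \<delta> + (\<epsilon> t \<delta>)\<^sup>2)"
    using risk swap tv AE_space
  proof eventually_elim
    case (elim \<omega>)
    show ?case
    proof
      assume "\<omega> \<in> E"
      let ?e = "\<epsilon> t \<delta>"
      have close: "norm (mean_profile X k (t - 1) \<omega> - \<mu> k) \<le> ?e" if "k \<in> {1..N+1}" for k
      proof -
        have "norm (mean_profile X k (t - 1) \<omega> - \<mu> k) \<le>
            (MAX k\<in>{1..N+1}. norm (mean_profile X k (t - 1) \<omega> - \<mu> k))"
          using that by (intro Max_ge) auto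
        also have "\<dots> \<le> ?e" using \<open>\<omega> \<in> E\<close> unfolding E_def by blast
        finally show ?thesis .
      qed
      have \<phi>0: "0 \<le> \<phi> (?gap k)" for k using phi_range by (auto simp: profile_gap_def Pi_iff)
      have \<phi>max: "\<phi> (?gap k) \<le> max_phi N \<phi> \<mu>" if "k \<in> {1..N}" for k
        unfolding max_phi_def using that by (intro Max_ge) auto
      have pmax0: "0 \<le> max_phi N \<phi> \<mu>" using \<phi>0[of 1] \<phi>max[of 1] \<open>N \<ge> 1\<close> by simp
      have "0 \<le> ?gap 1" by (simp add: profile_gap_def)
      also have "\<dots> \<le> max_gap N \<mu>"
        unfolding max_gap_def using \<open>N \<ge> 1\<close> by (intro Max_ge) auto
      finally have gap0: "0 \<le> max_gap N \<mu>" .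
      have e0: "0 \<le> ?e" using eps_nonneg \<open>t \<ge> 2\<close> \<delta> by blast
      have "measure (P t \<omega>) (exceed N (T \<omega>) (N+1)) \<le>
          min 1 (max 0 (?a \<omega>)) + (\<Sum>k=1..N. ?w \<omega> k * tv_dist (P t \<omega>) (Pswap t k \<omega>))"
        unfolding T_def
      proof (rule measure_exceed_le)
        show "P t \<omega> \<in> space (prob_algebra ?S)"
          using elim(4) by (intro regular_cond_law_space[OF P_law[OF t(1)]]) simp
        show "Pswap t k \<omega> \<in> space (prob_algebra ?S)" if "k \<in> {1..N}" for k
          using elim(4) by (intro regular_cond_law_space[OF Pswap_law[OF t(1) that]]) simp
        show "measure (Pswap t k \<omega>) (exceed N (heavy N (?w \<omega>) (?a \<omega>)) k) =
            measure (P t \<omega>) (swap_coords k (N+1) -` exceed N (heavy N (?w \<omega>) (?a \<omega>)) k \<inter> space ?S)"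
          if "k \<in> {1..N}" for k
          \<comment> \<open>The heavy family at \<open>\<omega>\<close> lies in
            \<open>Pow (Pow {1..N+1})\<close>, so the almost sure identity applies to it.\<close>
          using elim(2)[rule_format, OF that] by (simp add: heavy_def Pow_def Collect_mono)
      qed (rule weight_nonneg sum_weight weight_le_target)+
      also have "(\<Sum>k=1..N. ?w \<omega> k * tv_dist (P t \<omega>) (Pswap t k \<omega>)) \<le> (\<Sum>k=1..N. ?w \<omega> k * \<phi> (?gap k))"
        using elim(3) by (intro sum_mono mult_left_mono weight_nonneg) auto
      also have "\<dots> \<le> (\<Sum>k=1..N. oracle_weight N h \<mu> k * \<phi> (?gap k) +
          \<bar>?w \<omega> k - oracle_weight N h \<mu> k\<bar> * max_phi N \<phi> \<mu>)"
      proof (rule sum_mono)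
        fix k assume k: "k \<in> {1..N}"
        have "(?w \<omega> k - oracle_weight N h \<mu> k) * \<phi> (?gap k) \<le> \<bar>?w \<omega> k - oracle_weight N h \<mu> k\<bar> * max_phi N \<phi> \<mu>"
          using \<phi>0 \<phi>max[OF k] by (intro mult_mono) auto
        then show "?w \<omega> k * \<phi> (?gap k) \<le> oracle_weight N h \<mu> k * \<phi> (?gap k) +
          \<bar>?w \<omega> k - oracle_weight N h \<mu> k\<bar> * max_phi N \<phi> \<mu>" by (simp add: algebra_simps)
      qed
      also have "\<dots> = (\<Sum>k=1..N. oracle_weight N h \<mu> k * \<phi> (?gap k)) +
          (\<Sum>k=1..N. \<bar>?w \<omega> k - oracle_weight N h \<mu> k\<bar>) * max_phi N \<phi> \<mu>"
        by (simp add: sum.distrib sum_distrib_right)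
      also have "(\<Sum>k=1..N. \<bar>?w \<omega> k - oracle_weight N h \<mu> k\<bar>) * max_phi N \<phi> \<mu> \<le>
          4 * real N / h\<^sup>2 * (max_gap N \<mu> * ?e + ?e\<^sup>2) * max_phi N \<phi> \<mu>"
        using sum_abs_weight_diff_le[OF \<open>t \<ge> 2\<close> \<open>h > 0\<close> close] pmax0 by (rule mult_right_mono)
      \<comment> \<open>The perturbation bound yields the constant \<open>4\<close>; enlarging it to
        \<open>8\<close> is valid because all factors are nonnegative.\<close>
      also have "\<dots> \<le> 8 * real N / h\<^sup>2 * (max_gap N \<mu> * ?e + ?e\<^sup>2) * max_phi N \<phi> \<mu>"
        using gap0 e0 pmax0 by (intro mult_right_mono divide_right_mono add_nonneg_nonneg) auto
      also have "\<dots> = 8 * real N * max_phi N \<phi> \<mu> / h\<^sup>2 * (max_gap N \<mu> * ?e + ?e\<^sup>2)"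
        by simp
      finally show "real_cond_exp M ?F
          (indicator {\<omega> \<in> space M. Y (N+1) t \<omega> \<notin> pred_set N \<alpha> h \<gamma> s X Y R t \<omega>}) \<omega>
        \<le> min 1 (max 0 (?a \<omega>)) + (\<Sum>k=1..N. oracle_weight N h \<mu> k * \<phi> (?gap k))
          + 8 * real N * max_phi N \<phi> \<mu> / h\<^sup>2 * (max_gap N \<mu> * ?e + ?e\<^sup>2)"
        using elim(1) by simp
    qed
  qed
  ultimately show "\<exists>E\<in>sets M. measure M E \<ge> 1 - \<delta> \<and>
    (AE \<omega> in M. \<omega> \<in> E \<longrightarrow>
      real_cond_exp M ?F
        (indicator {\<omega> \<in> space M. Y (N+1) t \<omega> \<notin> pred_set N \<alpha> h \<gamma> s X Y R t \<omega>}) \<omega>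
      \<le> min 1 (max 0 (?a \<omega>)) + (\<Sum>k=1..N. oracle_weight N h \<mu> k * \<phi> (?gap k))
        + 8 * real N * max_phi N \<phi> \<mu> / h\<^sup>2 * (max_gap N \<mu> * \<epsilon> t \<delta> + (\<epsilon> t \<delta>)\<^sup>2))"
    by blast
qed

end
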